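(* Let $G$ be a discrete group and $(K,m,1_K)$ a $G$-equivariant monoid. The set $|\mathrm{Psdmn}^G(K)|$ of equivalence classes of pseudomonoid structures on $K$ can be described by the quotient $$|\mathrm{Psdmn}^G(K)|\cong H^3(\mathrm{Tot}^*(A^{*,*}(K\rtimes G,\mathbb T)))/\mathrm{Aut}_G(K).$$
   Context: $\mathbb T=S^1$, written multiplicatively. A $G$-equivariant monoid is a monoid with a left $G$-action by monoid automorphisms, written $g(k)$. $C^{p,q}(K\rtimes G,\mathbb T)$ is the group of maps $F:G^p\times K^q\to\mathbb T$, values $F[g_1|\dots|g_p||k_1|\dots|k_q]$, equal to $1$ if some $g_i$ or $k_j$ is the identity, with differentials $(\delta_GF)[g_1|\dots|g_{p+1}||k_1|\dots|k_q]=F[g_2|\dots|g_{p+1}||k_1|\dots|k_q]\prod_{i=1}^pF[\dots|g_ig_{i+1}|\dots||k_1|\dots|k_q]^{(-1)^i}F[g_1|\dots|g_p||g_{p+1}(k_1)|\dots|g_{p+1}(k_q)]^{(-1)^{p+1}}$ and $(\delta_KF)[g_1|\dots|g_p||k_1|\dots|k_{q+1}]=F[\dots||k_2|\dots|k_{q+1}]\prod_{j=1}^qF[\dots||\dots|k_jk_{j+1}|\dots]^{(-1)^j}F[\dots||k_1|\dots|k_q]^{(-1)^{q+1}}$. $A^{*,*}(K\rtimes G,\mathbb T)$ consists of the $C^{p,q}$ with $q>0$; its total complex has differential $\delta_G\oplus\delta_K^{(-1)^p}$. $\mathrm{Aut}_G(K)$ is the group of $G$-equivariant automorphisms of $K$: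 $\{f\in\mathrm{Aut}(K): f(g(k))=g(f(k))\ \forall g\in G,k\in K\}$. It acts on $A^{*,*}(K\rtimes G,\mathbb T)$ by pullback in the $K$-variables, hence on the cohomology. $\mathrm{Psdmn}^G(K)$ is the groupoid whose objects are the 3-cocycles $\alpha\oplus\beta\oplus\theta\in Z^3(\mathrm{Tot}^*(A^{*,*}(K\rtimes G,\mathbb T)))$ with $\alpha\in C^{2,1},\beta\in C^{1,2},\theta\in C^{0,3}$ (equivalently, pseudomonoid structures with strict unit on $K$ in the 2-category of $G$-sets with twist), and whose morphisms $\alpha\oplus\beta\oplus\theta\to\alpha'\oplus\beta'\oplus\theta'$ are the invertible morphisms of pseudomonoids, i.e. triples $(F,\chi,\kappa)$ with $F\in\mathrm{Aut}_G(K)$, $\chi\in C^{1,1}(K\rtimes G,\mathbb T)$, $\kappa\in C^{0,2}(K\rtimes G,\mathbb T)$ and $(\delta_G\oplus\delta_K^{(-1)^p})(\chi\oplus\kappa^{-1})=F^*\alpha'/\alpha\oplus F^*\beta'/\beta\oplus F^*\theta'/\theta$. $|\mathrm{Psdmn}^G(K)|$ is its set of isomorphism classes of objects. *)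

theory Defs
  imports Complex_Main "HOL-Algebra.Bij" "HOL-Algebra.Group_Action" "HOL-Algebra.Product_Groups"
begin

text \<open>
  \<open>auto K\<close> consists of the bijective multiplicative self-maps of \<open>carrier K\<close>, made extensional.
  Such maps preserve the unit because they are surjective, so this is the group of monoid
  automorphisms also when \<open>K\<close> is only a monoid.
\<close>

locale equivariant_monoid = group G + K: monoid K
  for G :: "('g, 'c) monoid_scheme" (structure) and K :: "('k, 'd) monoid_scheme"
    and act :: "'g \<Rightarrow> 'k \<Rightarrow> 'k" +
  assumes act_hom: "act \<in> hom G (AutoGroup K)"

definition equivariant_autos ::
    "('g, 'c) monoid_scheme \<Rightarrow> ('k, 'd) monoid_scheme \<Rightarrow> ('g \<Rightarrow> 'k \<Rightarrow> 'k) \<Rightarrow> ('k \<Rightarrow> 'k) monoid"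
  where "equivariant_autos G K act = AutoGroup K
    \<lparr>carrier := {f \<in> auto K. \<forall>g\<in>carrier G. \<forall>k\<in>carrier K. f (act g k) = act g (f k)}\<rparr>"

definition circle_group :: "complex monoid"
  where "circle_group = \<lparr>carrier = {z. cmod z = 1}, monoid.mult = (*), one = 1\<rparr>"


subsection \<open>The double complex\<close>

definition tuples :: "nat \<Rightarrow> ('a, 'b) monoid_scheme \<Rightarrow> 'a list set"
  where "tuples n M = {xs. length xs = n \<and> set xs \<subseteq> carrier M}"

definition cells ::
    "('g, 'c) monoid_scheme \<Rightarrow> ('k, 'd) monoid_scheme \<Rightarrow> nat \<Rightarrow> nat \<Rightarrow> ('g list \<times> 'k list) set"
  where "cells G K p q = tuples p G \<times> tuples q K"

definition cochains ::
    "('g, 'c) monoid_scheme \<Rightarrow> ('k, 'd) monoid_scheme \<Rightarrow> nat \<Rightarrow> nat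
      \<Rightarrow> ('g list \<times> 'k list \<Rightarrow> complex) monoid"
  where "cochains G K p q = product_group (cells G K p q) (\<lambda>_. circle_group)
    \<lparr>carrier := {F \<in> cells G K p q \<rightarrow>\<^sub>E carrier circle_group.
       \<forall>(gs, ks) \<in> cells G K p q. \<one>\<^bsub>G\<^esub> \<in> set gs \<or> \<one>\<^bsub>K\<^esub> \<in> set ks \<longrightarrow> F (gs, ks) = 1}\<rparr>"

text \<open>
  \<open>merge M i [x\<^sub>1, \<dots>, x\<^sub>n] = [x\<^sub>1, \<dots>, x\<^sub>i x\<^sub>i\<^sub>+\<^sub>1, \<dots>, x\<^sub>n]\<close> for \<open>1 \<le> i < n\<close>;
  note that \<open>(!)\<close> counts from 0.
\<close>

definition merge :: "('a, 'b) monoid_scheme \<Rightarrow> nat \<Rightarrow> 'a list \<Rightarrow> 'a list"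
  where "merge M i xs = take (i - 1) xs @ (xs ! (i - 1) \<otimes>\<^bsub>M\<^esub> xs ! i) # drop (i + 1) xs"

definition diff_G ::
    "('g, 'c) monoid_scheme \<Rightarrow> ('k, 'd) monoid_scheme \<Rightarrow> ('g \<Rightarrow> 'k \<Rightarrow> 'k) \<Rightarrow> nat \<Rightarrow> nat
      \<Rightarrow> ('g list \<times> 'k list \<Rightarrow> complex) \<Rightarrow> ('g list \<times> 'k list \<Rightarrow> complex)"
  where "diff_G G K act p q F = (\<lambda>(gs, ks) \<in> cells G K (p + 1) q.
      F (tl gs, ks)
    * (\<Prod>i=1..p. F (merge G i gs, ks) powi ((-1) ^ i))
    * F (butlast gs, map (act (last gs)) ks) powi ((-1) ^ (p + 1)))"

definition diff_K ::
    "('g, 'c) monoid_scheme \<Rightarrow> ('k, 'd) monoid_scheme \<Rightarrow> nat \<Rightarrow> nat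
      \<Rightarrow> ('g list \<times> 'k list \<Rightarrow> complex) \<Rightarrow> ('g list \<times> 'k list \<Rightarrow> complex)"
  where "diff_K G K p q F = (\<lambda>(gs, ks) \<in> cells G K p (q + 1).
      F (gs, tl ks)
    * (\<Prod>j=1..q. F (gs, merge K j ks) powi ((-1) ^ j))
    * F (gs, butlast ks) powi ((-1) ^ (q + 1)))"

definition pullback ::
    "('g, 'c) monoid_scheme \<Rightarrow> ('k, 'd) monoid_scheme \<Rightarrow> nat \<Rightarrow> nat \<Rightarrow> ('k \<Rightarrow> 'k)
      \<Rightarrow> ('g list \<times> 'k list \<Rightarrow> complex) \<Rightarrow> ('g list \<times> 'k list \<Rightarrow> complex)"
  where "pullback G K p q f F = (\<lambda>(gs, ks) \<in> cells G K p q. F (gs, map f ks))"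


subsection \<open>The total complex of the part with \<open>q > 0\<close>\<close>

text \<open>
  An element \<open>x\<close> of degree \<open>n\<close> is a family whose \<open>p\<close>-th member lies in bidegree \<open>(p, n - p)\<close>;
  the condition \<open>q > 0\<close> is \<open>p < n\<close>.
\<close>

type_synonym ('g, 'k) total = "nat \<Rightarrow> 'g list \<times> 'k list \<Rightarrow> complex"

definition Tot ::
    "('g, 'c) monoid_scheme \<Rightarrow> ('k, 'd) monoid_scheme \<Rightarrow> nat \<Rightarrow> ('g, 'k) total monoid"
  where "Tot G K n = product_group {..<n} (\<lambda>p. cochains G K p (n - p))"

text \<open>
  The component of \<open>tot_diff n x\<close> in bidegree \<open>(p, n + 1 - p)\<close> receives \<open>diff_G\<close> of the member of
  \<open>x\<close> in bidegree \<open>(p - 1, n + 1 - p)\<close> and \<open>diff_K\<close> to the power \<open>(-1)\<^sup>p\<close> of the one in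
  bidegree \<open>(p, n - p)\<close>, whenever these exist.
\<close>

definition tot_diff ::
    "('g, 'c) monoid_scheme \<Rightarrow> ('k, 'd) monoid_scheme \<Rightarrow> ('g \<Rightarrow> 'k \<Rightarrow> 'k) \<Rightarrow> nat
      \<Rightarrow> ('g, 'k) total \<Rightarrow> ('g, 'k) total"
  where "tot_diff G K act n x = (\<lambda>p\<in>{..<n + 1}. \<lambda>c\<in>cells G K p (n + 1 - p).
      (if p = 0 then 1 else diff_G G K act (p - 1) (n + 1 - p) (x (p - 1)) c)
    * (if p = n then 1 else diff_K G K p (n - p) (x p) c powi ((-1) ^ p)))"

definition tot_pullback ::
    "('g, 'c) monoid_scheme \<Rightarrow> ('k, 'd) monoid_scheme \<Rightarrow> nat \<Rightarrow> ('k \<Rightarrow> 'k)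
      \<Rightarrow> ('g, 'k) total \<Rightarrow> ('g, 'k) total"
  where "tot_pullback G K n f x = (\<lambda>p\<in>{..<n}. pullback G K p (n - p) f (x p))"

definition cocycles ::
    "('g, 'c) monoid_scheme \<Rightarrow> ('k, 'd) monoid_scheme \<Rightarrow> ('g \<Rightarrow> 'k \<Rightarrow> 'k) \<Rightarrow> nat
      \<Rightarrow> ('g, 'k) total set"
  where "cocycles G K act n = kernel (Tot G K n) (Tot G K (n + 1)) (tot_diff G K act n)"

fun coboundaries ::
    "('g, 'c) monoid_scheme \<Rightarrow> ('k, 'd) monoid_scheme \<Rightarrow> ('g \<Rightarrow> 'k \<Rightarrow> 'k) \<Rightarrow> nat
      \<Rightarrow> ('g, 'k) total set"
  where
    "coboundaries G K act 0 = {\<one>\<^bsub>Tot G K 0\<^esub>}"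
  | "coboundaries G K act (Suc n) = tot_diff G K act n ` carrier (Tot G K n)"

definition cohomology ::
    "('g, 'c) monoid_scheme \<Rightarrow> ('k, 'd) monoid_scheme \<Rightarrow> ('g \<Rightarrow> 'k \<Rightarrow> 'k) \<Rightarrow> nat
      \<Rightarrow> ('g, 'k) total set monoid"
  where "cohomology G K act n =
    Tot G K n\<lparr>carrier := cocycles G K act n\<rparr> Mod coboundaries G K act n"

definition cohomology_class ::
    "('g, 'c) monoid_scheme \<Rightarrow> ('k, 'd) monoid_scheme \<Rightarrow> ('g \<Rightarrow> 'k \<Rightarrow> 'k) \<Rightarrow> nat
      \<Rightarrow> ('g, 'k) total \<Rightarrow> ('g, 'k) total set"
  where "cohomology_class G K act n x = coboundaries G K act n #>\<^bsub>Tot G K n\<^esub> x"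

text \<open>
  For \<open>f\<close> in \<open>equivariant_autos G K act\<close> the cochain map \<open>f\<^sup>*\<close> is invertible and preserves
  coboundaries, so the image of the coset of \<open>x\<close> is the coset of \<open>f\<^sup>* x\<close>.  Since
  \<open>(f \<circ> h)\<^sup>* = h\<^sup>* \<circ> f\<^sup>*\<close>, this is a right action; its orbits are those of the left action
  by \<open>(f\<^sup>-\<^sup>1)\<^sup>*\<close>.
\<close>

definition cohomology_pullback ::
    "('g, 'c) monoid_scheme \<Rightarrow> ('k, 'd) monoid_scheme \<Rightarrow> nat \<Rightarrow> ('k \<Rightarrow> 'k)
      \<Rightarrow> ('g, 'k) total set \<Rightarrow> ('g, 'k) total set"
  where "cohomology_pullback G K n f X = tot_pullback G K n f ` X"


subsection \<open>The groupoid of pseudomonoid structures\<close>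

text \<open>An object \<open>\<alpha> \<oplus> \<beta> \<oplus> \<theta>\<close> is the family \<open>x\<close> with \<open>x 2 = \<alpha>\<close>, \<open>x 1 = \<beta>\<close>, \<open>x 0 = \<theta>\<close>.\<close>

definition Psdmn_objects ::
    "('g, 'c) monoid_scheme \<Rightarrow> ('k, 'd) monoid_scheme \<Rightarrow> ('g \<Rightarrow> 'k \<Rightarrow> 'k) \<Rightarrow> ('g, 'k) total set"
  where "Psdmn_objects G K act = cocycles G K act 3"

definition Psdmn_hom ::
    "('g, 'c) monoid_scheme \<Rightarrow> ('k, 'd) monoid_scheme \<Rightarrow> ('g \<Rightarrow> 'k \<Rightarrow> 'k)
      \<Rightarrow> ('g, 'k) total \<Rightarrow> ('g, 'k) total
      \<Rightarrow> (('k \<Rightarrow> 'k) \<times> ('g list \<times> 'k list \<Rightarrow> complex) \<times> ('g list \<times> 'k list \<Rightarrow> complex)) set"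
  where "Psdmn_hom G K act x x' = {(f, \<chi>, \<kappa>).
      f \<in> carrier (equivariant_autos G K act)
    \<and> \<chi> \<in> carrier (cochains G K 1 1) \<and> \<kappa> \<in> carrier (cochains G K 0 2)
    \<and> tot_diff G K act 2 (\<lambda>p\<in>{..<2}. if p = 0 then inv\<^bsub>cochains G K 0 2\<^esub> \<kappa> else \<chi>)
      = tot_pullback G K 3 f x' \<otimes>\<^bsub>Tot G K 3\<^esub> inv\<^bsub>Tot G K 3\<^esub> x}"

text \<open>
  All morphisms of the groupoid are invertible, so two objects are isomorphic iff there is a
  morphism between them.
\<close>

definition Psdmn_iso ::
    "('g, 'c) monoid_scheme \<Rightarrow> ('k, 'd) monoid_scheme \<Rightarrow> ('g \<Rightarrow> 'k \<Rightarrow> 'k)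
      \<Rightarrow> (('g, 'k) total \<times> ('g, 'k) total) set"
  where "Psdmn_iso G K act = {(x, x'). x \<in> Psdmn_objects G K act \<and> x' \<in> Psdmn_objects G K act
    \<and> Psdmn_hom G K act x x' \<noteq> {}}"

definition Psdmn_classes ::
    "('g, 'c) monoid_scheme \<Rightarrow> ('k, 'd) monoid_scheme \<Rightarrow> ('g \<Rightarrow> 'k \<Rightarrow> 'k)
      \<Rightarrow> ('g, 'k) total set set"
  where "Psdmn_classes G K act = Psdmn_objects G K act // Psdmn_iso G K act"

end

theory Submission
  imports Defs
begin

text \<open>
  The total differential is a homomorphism between the groups of normalised cochains and commutes
  with pullback along equivariant automorphisms, so these act on the cosets of the coboundaries.
  A pair \<open>(\<chi>, \<kappa>\<^sup>-\<^sup>1)\<close> is an arbitrary 2-cochain of the total complex, hence a morphism \<open>x \<rightarrow> x'\<close>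
  over \<open>f\<close> exists iff \<open>f\<^sup>* x' / x\<close> is a coboundary, i.e. iff \<open>f\<^sup>*\<close> maps the class of \<open>x'\<close> to that of
  \<open>x\<close>.
\<close>

section \<open>Faces of tuples\<close>

lemma tuples_length: "xs \<in> tuples n M \<Longrightarrow> length xs = n"
  by (simp add: tuples_def)

lemma tuples_nth: "xs \<in> tuples n M \<Longrightarrow> i < n \<Longrightarrow> xs ! i \<in> carrier M"
  by (auto simp: tuples_def)

lemma tl_in_tuples: "xs \<in> tuples (Suc n) M \<Longrightarrow> tl xs \<in> tuples n M"
  by (cases xs) (auto simp: tuples_def)

lemma butlast_in_tuples: "xs \<in> tuples (Suc n) M \<Longrightarrow> butlast xs \<in> tuples n M"
  by (auto simp: tuples_def dest: in_set_butlastD)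

lemma last_in_carrier: "xs \<in> tuples (Suc n) M \<Longrightarrow> last xs \<in> carrier M"
  by (cases xs rule: rev_cases) (auto simp: tuples_def)

lemma map_in_tuples:
  "xs \<in> tuples n M \<Longrightarrow> (\<And>x. x \<in> carrier M \<Longrightarrow> f x \<in> carrier N) \<Longrightarrow> map f xs \<in> tuples n N"
  by (auto simp: tuples_def)

lemma (in monoid) merge_in_tuples:
  assumes "xs \<in> tuples (Suc n) G" "i \<in> {1..n}"
  shows "merge G i xs \<in> tuples n G"
proof -
  have "xs ! (i - 1) \<otimes> xs ! i \<in> carrier G"
    using assms by (auto intro!: m_closed tuples_nth)
  with assms show ?thesis
    by (auto simp: tuples_def merge_def dest: in_set_takeD in_set_dropD)
qed

lemma map_merge:
  assumes "xs \<in> tuples (Suc n) M" "i \<in> {1..n}"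
    and "\<And>x y. x \<in> carrier M \<Longrightarrow> y \<in> carrier M \<Longrightarrow> f (x \<otimes>\<^bsub>M\<^esub> y) = f x \<otimes>\<^bsub>N\<^esub> f y"
  shows "map f (merge M i xs) = merge N i (map f xs)"
proof -
  have "f (xs ! (i - 1) \<otimes>\<^bsub>M\<^esub> xs ! i) = f (xs ! (i - 1)) \<otimes>\<^bsub>N\<^esub> f (xs ! i)"
    using assms by (auto intro!: assms(3) tuples_nth)
  with assms show ?thesis
    by (auto simp: merge_def take_map drop_map tuples_def)
qed

text \<open>A merge at \<open>i\<close> alters only the zero-based positions \<open>i - 1\<close>
  and \<open>i\<close>. The remaining entries lie in the initial or the final segment that is copied
  unchanged.\<close>

lemma in_set_merge:
  assumes "j < length xs" "j \<noteq> i" "j \<noteq> i - 1"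
  shows "xs ! j \<in> set (merge M i xs)"
proof (cases "j < i")
  case True
  with assms have "j < length (take (i - 1) xs)" "take (i - 1) xs ! j = xs ! j"
    by auto
  then have "xs ! j \<in> set (take (i - 1) xs)"
    by (metis nth_mem)
  then show ?thesis
    by (simp add: merge_def)
next
  case False
  with assms have "j - (i + 1) < length (drop (i + 1) xs)" "drop (i + 1) xs ! (j - (i + 1)) = xs ! j"
    by auto
  then have "xs ! j \<in> set (drop (i + 1) xs)"
    by (metis nth_mem)
  then show ?thesis
    by (simp add: merge_def)
qed

text \<open>Multiplying a neighbour by the unit merely deletes the unit. Hence the merges on both
  sides of position \<open>j\<close> yield the same list, which is the source of the cancellation
  below.\<close>

lemma (in monoid) merge_one:
  assumes "xs \<in> tuples (Suc n) G" "i \<in> {1..n}" "j \<in> {i - 1, i}" "xs ! j = \<one>"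
  shows "merge G i xs = take j xs @ drop (Suc j) xs"
proof -
  obtain k where i: "i = Suc k" "Suc k < length xs"
    using assms by (cases i) (auto simp: tuples_def)
  have "xs ! k \<in> carrier G" "xs ! Suc k \<in> carrier G"
    using assms i by (auto intro!: tuples_nth)
  with i assms show ?thesis
    by (auto simp: merge_def Cons_nth_drop_Suc take_Suc_conv_app_nth)
qed

text \<open>If \<open>xs ! j = \<one>\<close>, then all faces except the \<open>j\<close>-th and the \<open>(j + 1)\<close>-st still contain \<open>\<one>\<close>,
  and these two agree but occur with opposite signs.\<close>

lemma (in monoid) bar_product_degenerate:
  fixes f :: "'a list \<Rightarrow> complex"
  assumes xs: "xs \<in> tuples (Suc n) G" and one: "\<one> \<in> set xs"
    and nz: "\<And>ys. ys \<in> tuples n G \<Longrightarrow> f ys \<noteq> 0"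
    and norm: "\<And>ys. ys \<in> tuples n G \<Longrightarrow> \<one> \<in> set ys \<Longrightarrow> f ys = 1"
    and l1: "\<one> \<in> set (butlast xs) \<Longrightarrow> l = 1"
    and l2: "last xs = \<one> \<Longrightarrow> l = f (butlast xs)"
  shows "f (tl xs) * (\<Prod>i=1..n. f (merge G i xs) powi ((-1) ^ i)) * l powi ((-1) ^ (Suc n)) = 1"
proof -
  \<comment> \<open>The values on all \<open>n + 2\<close> faces, numbered from 0 to
    \<open>Suc n\<close>. The last value \<open>l\<close> is kept abstract because in
    \<open>diff_G\<close> it also involves the action on the other tuple.\<close>
  define t where "t i = (if i = 0 then f (tl xs) else if i \<le> n then f (merge G i xs) else l)" for i
  have len: "length xs = Suc n"
    using xs by (rule tuples_length)
  obtain j where j: "j < Suc n" "xs ! j = \<one>"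
    using one len by (metis in_set_conv_nth)
  \<comment> \<open>The value on the tuple with its unit at position \<open>j\<close> deleted; both
    exceptional faces turn out to have this value.\<close>
  define c where "c = f (take j xs @ drop (Suc j) xs)"
  have "take j xs @ drop (Suc j) xs \<in> tuples n G"
    using xs j by (auto simp: tuples_def dest: in_set_takeD in_set_dropD)
  then have c: "c \<noteq> 0"
    unfolding c_def by (rule nz)
  have t1: "t i = 1" if ij: "i \<le> Suc n" "i \<noteq> j" "i \<noteq> Suc j" for i
  proof -
    consider "i = 0" | "i \<in> {1..n}" | "i = Suc n"
      using ij by force
    then show ?thesis
    proof cases
      case 1
      then have "\<one> \<in> set (tl xs)"
        using ij j len by (cases xs) (auto simp: nth_Cons in_set_conv_nth split: nat.splits)
      with 1 show ?thesis
        by (simp add: t_def norm tl_in_tuples[OF xs])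
    next
      case 2
      then have "\<one> \<in> set (merge G i xs)"
        using ij j len in_set_merge[of j xs i G] by auto
      with 2 show ?thesis
        by (simp add: t_def norm merge_in_tuples[OF xs])
    next
      case 3
      then have "butlast xs ! j = \<one>" "j < length (butlast xs)"
        using ij j len by (auto simp: nth_butlast)
      then have "\<one> \<in> set (butlast xs)"
        by (metis nth_mem)
      with 3 show ?thesis
        by (simp add: t_def l1)
    qed
  qed
  \<comment> \<open>For \<open>j = 0\<close> this is the face dropping the head; otherwise it is the
    merge of the unit with its left neighbour.\<close>
  have tj: "t j = c"
  proof (cases "j = 0")
    case True
    then show ?thesis
      by (simp add: t_def c_def drop_Suc)
  next
    case False
    then show ?thesis
      using merge_one[OF xs, of j j] j by (simp add: t_def c_def)
  qed
  \<comment> \<open>For \<open>j = n\<close> the unit is the last entry and the face is the abstract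
    \<open>l\<close>, covered by \<open>l2\<close>; otherwise the unit is merged with its right
    neighbour.\<close>
  have tSj: "t (Suc j) = c"
  proof (cases "j = n")
    case True
    then have "last xs = \<one>"
      using j len by (metis diff_Suc_1 last_conv_nth length_0_conv nat.distinct(1))
    with True show ?thesis
      by (simp add: t_def c_def l2 len butlast_conv_take)
  next
    case False
    then show ?thesis
      using merge_one[OF xs, of "Suc j" j] j by (simp add: t_def c_def)
  qed
  have "f (tl xs) * (\<Prod>i=1..n. f (merge G i xs) powi ((-1) ^ i)) * l powi ((-1) ^ (Suc n))
      = (\<Prod>i\<le>Suc n. t i powi ((-1) ^ i))"
  proof -
    have "{..n} = insert 0 {1..n}"
      by auto
    then show ?thesis
      by (simp add: t_def)
  qed
  \<comment> \<open>All other factors are powers of 1. The two that remain are \<open>c\<close> and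
    its inverse in some order, so nonvanishing of \<open>c\<close> finishes the computation.\<close>
  also have "\<dots> = (\<Prod>i\<in>{j, Suc j}. t i powi ((-1) ^ i))"
    using j by (intro prod.mono_neutral_right) (auto simp: t1)
  also have "\<dots> = 1"
    using c by (simp add: tj tSj power_int_minus)
  finally show ?thesis .
qed


section \<open>Cochains\<close>

lemma group_circle_group: "group circle_group"
proof (rule groupI)
  fix x assume "x \<in> carrier circle_group"
  then show "\<exists>y\<in>carrier circle_group. y \<otimes>\<^bsub>circle_group\<^esub> x = \<one>\<^bsub>circle_group\<^esub>"
    by (intro bexI[of _ "inverse x"]) (auto simp: circle_group_def norm_inverse intro!: left_inverse)
qed (auto simp: circle_group_def norm_mult)

lemma inv_circle_group: "z \<in> carrier circle_group \<Longrightarrow> inv\<^bsub>circle_group\<^esub> z = inverse z"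
  by (rule group.inv_equality[OF group_circle_group]) (auto simp: circle_group_def norm_inverse intro!: left_inverse)

lemma cells_iff: "(gs, ks) \<in> cells G K p q \<longleftrightarrow> gs \<in> tuples p G \<and> ks \<in> tuples q K"
  by (simp add: cells_def)

lemma cochains_iff:
  "F \<in> carrier (cochains G K p q) \<longleftrightarrow> F \<in> extensional (cells G K p q)
    \<and> (\<forall>gs ks. (gs, ks) \<in> cells G K p q \<longrightarrow> cmod (F (gs, ks)) = 1
        \<and> (\<one>\<^bsub>G\<^esub> \<in> set gs \<or> \<one>\<^bsub>K\<^esub> \<in> set ks \<longrightarrow> F (gs, ks) = 1))"
  by (auto simp: cochains_def circle_group_def PiE_iff)

lemma cochains_norm:
  "F \<in> carrier (cochains G K p q) \<Longrightarrow> gs \<in> tuples p G \<Longrightarrow> ks \<in> tuples q K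
    \<Longrightarrow> cmod (F (gs, ks)) = 1"
  by (simp add: cochains_iff cells_iff)

lemma cochains_nonzero:
  "F \<in> carrier (cochains G K p q) \<Longrightarrow> gs \<in> tuples p G \<Longrightarrow> ks \<in> tuples q K
    \<Longrightarrow> F (gs, ks) \<noteq> 0"
  using cochains_norm by fastforce

lemma cochains_normalized:
  "F \<in> carrier (cochains G K p q) \<Longrightarrow> gs \<in> tuples p G \<Longrightarrow> ks \<in> tuples q K
    \<Longrightarrow> \<one>\<^bsub>G\<^esub> \<in> set gs \<or> \<one>\<^bsub>K\<^esub> \<in> set ks \<Longrightarrow> F (gs, ks) = 1"
  by (auto simp: cochains_iff cells_iff)

lemma mult_cochains:
  "F \<otimes>\<^bsub>cochains G K p q\<^esub> H = (\<lambda>c\<in>cells G K p q. F c * H c)"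
  by (simp add: cochains_def circle_group_def)

text \<open>Normalisation prescribes the value 1 on degenerate cells, a condition stable under
  pointwise products and inverses, so it cuts out a subgroup of the full product of circles.\<close>

lemma group_cochains: "group (cochains G K p q)"
proof -
  let ?P = "product_group (cells G K p q) (\<lambda>_. circle_group)"
  interpret P: group ?P
    by (simp add: group_circle_group)
  let ?H = "carrier (cochains G K p q)"
  have "subgroup ?H ?P"
  proof (rule P.subgroupI)
    show "?H \<subseteq> carrier ?P"
      by (auto simp: cochains_def)
    have "(\<lambda>c\<in>cells G K p q. 1) \<in> ?H"
      by (auto simp: cochains_iff)
    then show "?H \<noteq> {}"
      by blast
  next
    fix F assume F: "F \<in> ?H"
    then have "F \<in> (\<Pi>\<^sub>E c\<in>cells G K p q. carrier circle_group)"
      by (simp add: cochains_def)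
    then have "inv\<^bsub>?P\<^esub> F = (\<lambda>c\<in>cells G K p q. inverse (F c))"
      by (auto simp: group_circle_group inv_circle_group PiE_iff cong: restrict_cong)
    with F show "inv\<^bsub>?P\<^esub> F \<in> ?H"
      by (simp add: cochains_iff norm_inverse)
  next
    fix F H assume "F \<in> ?H" "H \<in> ?H"
    then show "F \<otimes>\<^bsub>?P\<^esub> H \<in> ?H"
      by (simp add: cochains_iff circle_group_def norm_mult)
  qed
  moreover have "cochains G K p q = ?P\<lparr>carrier := ?H\<rparr>"
    by (simp add: cochains_def)
  ultimately show ?thesis
    by (metis P.subgroup_imp_group)
qed

lemma group_Tot: "group (Tot G K n)"
  by (simp add: Tot_def group_cochains)

lemma carrier_Tot: "carrier (Tot G K n) = (\<Pi>\<^sub>E p\<in>{..<n}. carrier (cochains G K p (n - p)))"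
  by (simp add: Tot_def)

lemma mult_Tot: "x \<otimes>\<^bsub>Tot G K n\<^esub> y = (\<lambda>p\<in>{..<n}. x p \<otimes>\<^bsub>cochains G K p (n - p)\<^esub> y p)"
  by (simp add: Tot_def)

lemma Tot_component:
  "x \<in> carrier (Tot G K n) \<Longrightarrow> p < n \<Longrightarrow> x p \<in> carrier (cochains G K p (n - p))"
  by (auto simp: carrier_Tot)


section \<open>The differentials are homomorphisms\<close>

lemma auto_closed: "f \<in> auto K \<Longrightarrow> k \<in> carrier K \<Longrightarrow> f k \<in> carrier K"
  by (auto simp: auto_def hom_def)

lemma auto_mult:
  "f \<in> auto K \<Longrightarrow> k \<in> carrier K \<Longrightarrow> l \<in> carrier K \<Longrightarrow> f (k \<otimes>\<^bsub>K\<^esub> l) = f k \<otimes>\<^bsub>K\<^esub> f l"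
  by (auto simp: auto_def hom_def)

text \<open>Elements of a monoid need not be cancellable, so surjectivity does the work: a preimage
  \<open>k\<close> of the unit lets \<open>f \<one>\<close> be multiplied by \<open>f k\<close>
  without change and then absorbed into \<open>f k\<close>.\<close>

lemma (in monoid) auto_one:
  assumes "f \<in> auto G" shows "f \<one> = \<one>"
proof -
  have "f ` carrier G = carrier G"
    using assms by (simp add: auto_def Bij_def bij_betw_def)
  then obtain k where k: "k \<in> carrier G" "f k = \<one>"
    by (metis image_iff one_closed)
  then have "f \<one> = f \<one> \<otimes> f k"
    using assms by (simp add: auto_closed)
  also have "\<dots> = f (\<one> \<otimes> k)"
    using assms k by (simp only: auto_mult one_closed)
  also have "\<dots> = \<one>"
    using k by simp
  finally show ?thesis .
qed

context equivariant_monoid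
begin

lemma act_auto: "g \<in> carrier G \<Longrightarrow> act g \<in> auto K"
  using act_hom by (auto simp: hom_def AutoGroup_def)

lemma act_closed: "g \<in> carrier G \<Longrightarrow> k \<in> carrier K \<Longrightarrow> act g k \<in> carrier K"
  by (simp add: act_auto auto_closed)

lemma act_one:
  assumes "k \<in> carrier K" shows "act \<one> k = k"
proof -
  \<comment> \<open>Automorphisms multiply as bijections do, so the target may be enlarged to the
    group of all bijections, whose unit is the identity on the carrier.\<close>
  have "act \<in> hom G (BijGroup (carrier K))"
    using act_hom by (auto simp: hom_def AutoGroup_def auto_def BijGroup_def)
  then have "act \<one> = \<one>\<^bsub>BijGroup (carrier K)\<^esub>"
    by (intro hom_one is_group group_BijGroup)
  with assms show ?thesis
    by (simp add: BijGroup_def)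
qed

lemma map_act_one: "ks \<in> tuples q K \<Longrightarrow> map (act \<one>) ks = ks"
  by (auto simp: tuples_def act_one intro!: map_idI)

lemma map_act_in_tuples: "g \<in> carrier G \<Longrightarrow> ks \<in> tuples q K \<Longrightarrow> map (act g) ks \<in> tuples q K"
  by (auto intro: map_in_tuples act_closed)

lemma one_in_map_act:
  "g \<in> carrier G \<Longrightarrow> \<one>\<^bsub>K\<^esub> \<in> set ks \<Longrightarrow> \<one>\<^bsub>K\<^esub> \<in> set (map (act g) ks)"
  by (metis K.auto_one act_auto image_eqI list.set_map)

lemmas face_in_tuples = tl_in_tuples butlast_in_tuples merge_in_tuples K.merge_in_tuples
  map_act_in_tuples last_in_carrier

text \<open>A unit in the \<open>K\<close>-tuple survives in every face, the twisted last one
  included, because each \<open>act g\<close> fixes the unit. A unit in the \<open>G\<close>-tuple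
  makes two adjacent faces cancel.\<close>

lemma diff_G_cochain:
  assumes F: "F \<in> carrier (cochains G K p q)"
  shows "diff_G G K act p q F \<in> carrier (cochains G K (Suc p) q)"
proof -
  have "cmod (diff_G G K act p q F (gs, ks)) = 1
      \<and> (\<one> \<in> set gs \<or> \<one>\<^bsub>K\<^esub> \<in> set ks \<longrightarrow> diff_G G K act p q F (gs, ks) = 1)"
    if gs: "gs \<in> tuples (Suc p) G" and ks: "ks \<in> tuples q K" for gs ks
  proof (intro conjI impI)
    have e: "diff_G G K act p q F (gs, ks) = F (tl gs, ks)
      * (\<Prod>i=1..p. F (merge G i gs, ks) powi ((-1) ^ i))
      * F (butlast gs, map (act (last gs)) ks) powi ((-1) ^ Suc p)"
      using gs ks by (simp add: diff_G_def cells_iff)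
    show "cmod (diff_G G K act p q F (gs, ks)) = 1"
      unfolding e using gs ks
      by (simp add: norm_mult norm_power_int cochains_norm[OF F] face_in_tuples flip: prod_norm
          del: power_Suc)
    assume "\<one> \<in> set gs \<or> \<one>\<^bsub>K\<^esub> \<in> set ks"
    then show "diff_G G K act p q F (gs, ks) = 1"
    proof
      assume "\<one>\<^bsub>K\<^esub> \<in> set ks"
      with gs ks show ?thesis
        unfolding e
        by (simp add: cochains_normalized[OF F] face_in_tuples one_in_map_act del: power_Suc set_map)
    next
      assume "\<one> \<in> set gs"
      \<comment> \<open>Here \<open>l\<close> is the value on the twisted last face. If
        \<open>last gs\<close> is the unit, the twist is trivial on \<open>ks\<close> and
        \<open>l\<close> is the untwisted value at \<open>butlast gs\<close>, as \<open>l2\<close>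
        demands.\<close>
      then show ?thesis
        unfolding e using gs ks
        by (intro bar_product_degenerate[where f = "\<lambda>gs. F (gs, ks)"])
          (auto simp: cochains_nonzero[OF F] cochains_normalized[OF F] face_in_tuples map_act_one)
    qed
  qed
  then show ?thesis
    by (auto simp: cochains_iff cells_iff) (simp add: diff_G_def)
qed

text \<open>The same argument with the two tuples exchanged. The last face carries no twist, so it
  is the value at \<open>butlast ks\<close> from the outset.\<close>

lemma diff_K_cochain:
  assumes F: "F \<in> carrier (cochains G K p q)"
  shows "diff_K G K p q F \<in> carrier (cochains G K p (Suc q))"
proof -
  have "cmod (diff_K G K p q F (gs, ks)) = 1
      \<and> (\<one> \<in> set gs \<or> \<one>\<^bsub>K\<^esub> \<in> set ks \<longrightarrow> diff_K G K p q F (gs, ks) = 1)"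
    if gs: "gs \<in> tuples p G" and ks: "ks \<in> tuples (Suc q) K" for gs ks
  proof (intro conjI impI)
    have e: "diff_K G K p q F (gs, ks) = F (gs, tl ks)
      * (\<Prod>j=1..q. F (gs, merge K j ks) powi ((-1) ^ j)) * F (gs, butlast ks) powi ((-1) ^ Suc q)"
      using gs ks by (simp add: diff_K_def cells_iff)
    show "cmod (diff_K G K p q F (gs, ks)) = 1"
      unfolding e using gs ks
      by (simp add: norm_mult norm_power_int cochains_norm[OF F] face_in_tuples flip: prod_norm
          del: power_Suc)
    assume "\<one> \<in> set gs \<or> \<one>\<^bsub>K\<^esub> \<in> set ks"
    then show "diff_K G K p q F (gs, ks) = 1"
    proof
      assume "\<one> \<in> set gs"
      with gs ks show ?thesis
        unfolding e by (simp add: cochains_normalized[OF F] face_in_tuples del: power_Suc)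
    next
      assume "\<one>\<^bsub>K\<^esub> \<in> set ks"
      then show ?thesis
        unfolding e using gs ks
        by (intro K.bar_product_degenerate[where f = "\<lambda>ks. F (gs, ks)"])
          (auto simp: cochains_nonzero[OF F] cochains_normalized[OF F] face_in_tuples)
    qed
  qed
  then show ?thesis
    by (auto simp: cochains_iff cells_iff) (simp add: diff_K_def)
qed

lemma diff_G_mult:
  "diff_G G K act p q (F \<otimes>\<^bsub>cochains G K p q\<^esub> H)
    = diff_G G K act p q F \<otimes>\<^bsub>cochains G K (Suc p) q\<^esub> diff_G G K act p q H"
  by (auto simp: diff_G_def mult_cochains cells_iff face_in_tuples power_int_mult_distrib
      prod.distrib intro!: restrict_ext simp del: power_Suc)

lemma diff_K_mult:
  "diff_K G K p q (F \<otimes>\<^bsub>cochains G K p q\<^esub> H)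
    = diff_K G K p q F \<otimes>\<^bsub>cochains G K p (Suc q)\<^esub> diff_K G K p q H"
  by (auto simp: diff_K_def mult_cochains cells_iff face_in_tuples power_int_mult_distrib
      prod.distrib intro!: restrict_ext simp del: power_Suc)

section \<open>The total differential and its image\<close>

lemma tot_diff_closed:
  assumes x: "x \<in> carrier (Tot G K n)"
  shows "tot_diff G K act n x \<in> carrier (Tot G K (Suc n))"
proof -
  have "tot_diff G K act n x p \<in> carrier (cochains G K p (Suc n - p))" if p: "p < Suc n" for p
  proof -
    \<comment> \<open>The member of \<open>x\<close> at index \<open>p - 1\<close> has
      \<open>K\<close>-degree \<open>n - (p - 1)\<close>, which equals \<open>Suc n - p\<close> once
      \<open>p\<close> is positive.\<close>
    have 1: "diff_G G K act (p - 1) (Suc n - p) (x (p - 1)) \<in> carrier (cochains G K p (Suc n - p))"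
      if "p \<noteq> 0"
      using diff_G_cochain[OF Tot_component[OF x, of "p - 1"]] that p by (cases p) auto
    \<comment> \<open>At \<open>p = n\<close> the source would have \<open>K\<close>-degree 0, which
      the complex excludes.\<close>
    have 2: "diff_K G K p (n - p) (x p) \<in> carrier (cochains G K p (Suc n - p))" if "p \<noteq> n"
      using diff_K_cochain[OF Tot_component[OF x, of p]] that p by (auto simp: Suc_diff_le)
    show ?thesis
      using p 1 2 by (auto simp: tot_diff_def cochains_iff norm_mult norm_power_int)
  qed
  moreover have "tot_diff G K act n x \<in> extensional {..<Suc n}"
    by (simp add: tot_diff_def)
  ultimately show ?thesis
    by (auto simp: carrier_Tot PiE_iff)
qed

lemma tot_diff_hom: "tot_diff G K act n \<in> hom (Tot G K n) (Tot G K (Suc n))"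
proof (rule homI)
  fix x y assume "x \<in> carrier (Tot G K n)" "y \<in> carrier (Tot G K n)"
  show "tot_diff G K act n (x \<otimes>\<^bsub>Tot G K n\<^esub> y)
      = tot_diff G K act n x \<otimes>\<^bsub>Tot G K (Suc n)\<^esub> tot_diff G K act n y"
  proof (rule ext, rule ext)
    fix p c
    let ?xy = "x \<otimes>\<^bsub>Tot G K n\<^esub> y"
    have 1: "diff_G G K act (p - 1) (Suc n - p) (?xy (p - 1)) c
        = diff_G G K act (p - 1) (Suc n - p) (x (p - 1)) c
          * diff_G G K act (p - 1) (Suc n - p) (y (p - 1)) c"
      if "p \<noteq> 0" "p \<le> n" "c \<in> cells G K p (Suc n - p)"
      using that diff_G_mult[of "p - 1" "Suc n - p" "x (p - 1)" "y (p - 1)"]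
      by (cases p) (auto simp: mult_Tot mult_cochains[of _ _ "Suc _"])
    have 2: "diff_K G K p (n - p) (?xy p) c
        = diff_K G K p (n - p) (x p) c * diff_K G K p (n - p) (y p) c"
      if "p \<noteq> n" "p \<le> n" "c \<in> cells G K p (Suc n - p)"
      using that diff_K_mult[of p "n - p" "x p" "y p"]
      by (auto simp: mult_Tot mult_cochains[of _ _ _ "Suc _"] Suc_diff_le)
    show "tot_diff G K act n ?xy p c
        = (tot_diff G K act n x \<otimes>\<^bsub>Tot G K (Suc n)\<^esub> tot_diff G K act n y) p c"
    proof (cases "p \<le> n")
      case True
      then show ?thesis
        using 1 2
        by (auto simp: tot_diff_def mult_Tot[of _ _ "Suc n"] mult_cochains[of _ _ p "Suc n - p"]
            power_int_mult_distrib)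
    next
      case False
      then show ?thesis
        by (simp add: tot_diff_def mult_Tot[of _ _ "Suc n"])
    qed
  qed
qed (rule tot_diff_closed)

lemma subgroup_coboundaries: "subgroup (coboundaries G K act n) (Tot G K n)"
proof (cases n)
  case 0
  then show ?thesis
    by (simp add: group.triv_subgroup group_Tot)
next
  case (Suc m)
  then show ?thesis
    using group_hom.img_is_subgroup[OF group_hom.intro[OF group_Tot group_Tot
          group_hom_axioms.intro[OF tot_diff_hom]]]
    by simp
qed


section \<open>Pullback along equivariant automorphisms\<close>

abbreviation (input) "Aut \<equiv> equivariant_autos G K act"

lemma Aut_auto: "f \<in> carrier Aut \<Longrightarrow> f \<in> auto K"
  by (simp add: equivariant_autos_def)

lemma Aut_closed: "f \<in> carrier Aut \<Longrightarrow> k \<in> carrier K \<Longrightarrow> f k \<in> carrier K"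
  by (simp add: Aut_auto auto_closed)

lemma Aut_act:
  "f \<in> carrier Aut \<Longrightarrow> g \<in> carrier G \<Longrightarrow> k \<in> carrier K \<Longrightarrow> f (act g k) = act g (f k)"
  by (simp add: equivariant_autos_def)

lemma Aut_mult:
  "f \<in> carrier Aut \<Longrightarrow> h \<in> carrier Aut \<Longrightarrow> k \<in> carrier K \<Longrightarrow> (f \<otimes>\<^bsub>Aut\<^esub> h) k = f (h k)"
  by (simp add: equivariant_autos_def AutoGroup_def BijGroup_def auto_def compose_def)

lemma Aut_one: "k \<in> carrier K \<Longrightarrow> \<one>\<^bsub>Aut\<^esub> k = k"
  by (simp add: equivariant_autos_def AutoGroup_def BijGroup_def)

text \<open>Multiplicativity and equivariance are equations between values of a bijection, hence
  pass to composites and to the inverse. So the equivariant automorphisms form a subgroup of all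
  bijections of the carrier.\<close>

lemma group_Aut: "group Aut"
proof -
  let ?B = "BijGroup (carrier K)"
  let ?E = "{f \<in> auto K. \<forall>g\<in>carrier G. \<forall>k\<in>carrier K. f (act g k) = act g (f k)}"
  interpret B: group ?B
    by (rule group_BijGroup)
  have "subgroup ?E ?B"
  proof (rule B.subgroupI)
    show "?E \<subseteq> carrier ?B"
      by (auto simp: auto_def BijGroup_def)
    have "(\<lambda>k\<in>carrier K. k) \<in> ?E"
      by (auto simp: auto_def hom_def id_Bij act_closed)
    then show "?E \<noteq> {}"
      by blast
  next
    fix f assume f: "f \<in> ?E"
    then have bij: "f \<in> Bij (carrier K)" and bb: "bij_betw f (carrier K) (carrier K)"
      by (auto simp: auto_def Bij_def)
    let ?i = "\<lambda>k\<in>carrier K. inv_into (carrier K) f k"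
    note mem = Bij_inv_into_mem[OF bij]
    have ff: "f (inv_into (carrier K) f k) = k" if "k \<in> carrier K" for k
      using bb that by (metis bij_betw_inv_into_right)
    \<comment> \<open>Each identity for the inverse is checked after applying \<open>f\<close>,
      where it becomes the corresponding identity for \<open>f\<close>.\<close>
    have eqI: "inv_into (carrier K) f k = l" if "l \<in> carrier K" "f l = k" for k l
      using bb that by (metis bij_betw_inv_into_left)
    have "?i \<in> auto K"
      using f by (auto simp: auto_def hom_def restrict_inv_into_Bij[OF bij] mem ff intro!: eqI)
    moreover have "?i (act g k) = act g (?i k)" if "g \<in> carrier G" "k \<in> carrier K" for g k
      using f that by (auto simp: mem ff act_closed intro!: eqI)
    ultimately show "inv\<^bsub>?B\<^esub> f \<in> ?E"
      by (simp add: inv_BijGroup[OF bij] del: restrict_apply)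
  next
    fix f h assume "f \<in> ?E" "h \<in> ?E"
    then show "f \<otimes>\<^bsub>?B\<^esub> h \<in> ?E"
      by (auto simp: auto_def hom_def BijGroup_def compose_Bij[unfolded compose_def] compose_def
          Pi_iff act_closed)
  qed
  then show ?thesis
    unfolding equivariant_autos_def AutoGroup_def using B.subgroup_imp_group by simp
qed

section \<open>Pullback of cochains and its compatibility with the differentials\<close>

lemma map_Aut_in_tuples: "f \<in> carrier Aut \<Longrightarrow> ks \<in> tuples q K \<Longrightarrow> map f ks \<in> tuples q K"
  by (auto intro: map_in_tuples Aut_closed)

lemma one_in_map_Aut: "f \<in> carrier Aut \<Longrightarrow> \<one>\<^bsub>K\<^esub> \<in> set ks \<Longrightarrow> \<one>\<^bsub>K\<^esub> \<in> set (map f ks)"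
  by (metis K.auto_one Aut_auto image_eqI list.set_map)

lemma pullback_cochain:
  assumes "f \<in> carrier Aut" "F \<in> carrier (cochains G K p q)"
  shows "pullback G K p q f F \<in> carrier (cochains G K p q)"
  using assms one_in_map_Aut[OF assms(1)]
  by (auto simp: cochains_iff pullback_def cells_iff map_Aut_in_tuples)

lemma pullback_mult:
  "f \<in> carrier Aut \<Longrightarrow> pullback G K p q f (F \<otimes>\<^bsub>cochains G K p q\<^esub> H)
    = pullback G K p q f F \<otimes>\<^bsub>cochains G K p q\<^esub> pullback G K p q f H"
  by (auto simp: pullback_def mult_cochains cells_iff map_Aut_in_tuples intro!: restrict_ext)

text \<open>Only the last face changes the \<open>K\<close>-tuple, and there equivariance lets
  \<open>f\<close> pass the action.\<close>

lemma pullback_diff_G: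
  assumes f: "f \<in> carrier Aut"
  shows "pullback G K (Suc p) q f (diff_G G K act p q F) = diff_G G K act p q (pullback G K p q f F)"
proof -
  have "map f (map (act g) ks) = map (act g) (map f ks)"
    if "g \<in> carrier G" "ks \<in> tuples q K" for g ks
    using that f by (auto simp: tuples_def Aut_act)
  then show ?thesis
    using f by (auto simp: pullback_def diff_G_def cells_iff map_Aut_in_tuples face_in_tuples
        intro!: restrict_ext simp del: power_Suc map_map)
qed

text \<open>Multiplicativity of \<open>f\<close> lets it pass the merges; dropping the first or last
  entry commutes with any entrywise map.\<close>

lemma pullback_diff_K:
  assumes f: "f \<in> carrier Aut"
  shows "pullback G K p (Suc q) f (diff_K G K p q F) = diff_K G K p q (pullback G K p q f F)"
proof -
  have "map f (merge K j ks) = merge K j (map f ks)" if "j \<in> {1..q}" "ks \<in> tuples (Suc q) K" for j ks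
    using that Aut_auto[OF f] by (intro map_merge[of _ q]) (auto simp: auto_mult)
  then show ?thesis
    using f by (auto simp: pullback_def diff_K_def cells_iff map_Aut_in_tuples face_in_tuples
        map_tl map_butlast intro!: restrict_ext simp del: power_Suc)
qed

lemma tot_pullback_closed:
  "f \<in> carrier Aut \<Longrightarrow> x \<in> carrier (Tot G K n) \<Longrightarrow> tot_pullback G K n f x \<in> carrier (Tot G K n)"
  by (auto simp: carrier_Tot tot_pullback_def intro!: pullback_cochain)

lemma tot_pullback_mult:
  "f \<in> carrier Aut \<Longrightarrow> tot_pullback G K n f (x \<otimes>\<^bsub>Tot G K n\<^esub> y)
    = tot_pullback G K n f x \<otimes>\<^bsub>Tot G K n\<^esub> tot_pullback G K n f y"
  by (auto simp: tot_pullback_def mult_Tot pullback_mult intro!: restrict_ext)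

lemma tot_pullback_tot_diff:
  assumes f: "f \<in> carrier Aut"
  shows "tot_pullback G K (Suc n) f (tot_diff G K act n x)
    = tot_diff G K act n (tot_pullback G K n f x)"
proof (rule ext, rule ext)
  fix p c
  show "tot_pullback G K (Suc n) f (tot_diff G K act n x) p c
      = tot_diff G K act n (tot_pullback G K n f x) p c"
  proof (cases "p \<le> n \<and> c \<in> cells G K p (Suc n - p)")
    case True
    obtain gs ks where c: "c = (gs, ks)"
      by force
    have mf: "(gs, map f ks) \<in> cells G K p (Suc n - p)"
      using True c f by (simp add: cells_iff map_Aut_in_tuples)
    have 1: "diff_G G K act (p - 1) (Suc n - p) (x (p - 1)) (gs, map f ks)
        = diff_G G K act (p - 1) (Suc n - p) (tot_pullback G K n f x (p - 1)) (gs, ks)"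
      if "p \<noteq> 0"
      using that True c fun_cong[OF pullback_diff_G[OF f, of "p - 1" "Suc n - p" "x (p - 1)"], of c]
      by (cases p) (auto simp: tot_pullback_def pullback_def[of _ _ "Suc _"])
    have 2: "diff_K G K p (n - p) (x p) (gs, map f ks)
        = diff_K G K p (n - p) (tot_pullback G K n f x p) (gs, ks)"
      if "p \<noteq> n"
      using that True c fun_cong[OF pullback_diff_K[OF f, of p "n - p" "x p"], of c]
      by (auto simp: tot_pullback_def pullback_def[of _ _ _ "Suc _"] Suc_diff_le)
    have "tot_pullback G K (Suc n) f (tot_diff G K act n x) p c
        = tot_diff G K act n x p (gs, map f ks)"
      using True c by (simp add: tot_pullback_def pullback_def)
    also have "\<dots> = tot_diff G K act n (tot_pullback G K n f x) p c"
      using True c mf 1 2 by (auto simp: tot_diff_def)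
    finally show ?thesis .
  next
    case False
    \<comment> \<open>Outside the index range or the cells, both sides are restrictions and take the
      same default value.\<close>
    then show ?thesis
      by (auto simp: tot_pullback_def tot_diff_def pullback_def)
  qed
qed

section \<open>Functoriality of pullback and the action on cohomology classes\<close>

lemma tot_pullback_comp:
  assumes "f \<in> carrier Aut" "h \<in> carrier Aut"
  shows "tot_pullback G K n (f \<otimes>\<^bsub>Aut\<^esub> h) x = tot_pullback G K n h (tot_pullback G K n f x)"
proof -
  \<comment> \<open>On the carrier the product is composition with \<open>h\<close> applied first,
    which makes pullback contravariant.\<close>
  have "map (f \<otimes>\<^bsub>Aut\<^esub> h) ks = map f (map h ks)" if "ks \<in> tuples q K" for q ks
    using that assms by (auto simp: tuples_def Aut_mult)
  then show ?thesis
    using assms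
    by (auto simp: tot_pullback_def pullback_def cells_iff map_Aut_in_tuples
        intro!: restrict_ext simp del: map_map)
qed

lemma tot_pullback_one:
  assumes "x \<in> carrier (Tot G K n)"
  shows "tot_pullback G K n \<one>\<^bsub>Aut\<^esub> x = x"
proof (rule ext)
  fix p
  have "map \<one>\<^bsub>Aut\<^esub> ks = ks" if "ks \<in> tuples q K" for q ks
    using that by (auto simp: tuples_def Aut_one intro!: map_idI)
  then have "pullback G K p (n - p) \<one>\<^bsub>Aut\<^esub> F = F" if "F \<in> carrier (cochains G K p (n - p))" for F
    using that
    by (intro ext) (auto simp: pullback_def cochains_iff cells_iff extensional_def restrict_def)
  then show "tot_pullback G K n \<one>\<^bsub>Aut\<^esub> x p = x p"
    using assms by (auto simp: tot_pullback_def carrier_Tot PiE_iff extensional_def)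
qed

text \<open>Commuting with the differential gives one inclusion for every equivariant automorphism;
  applying it to the inverse of \<open>f\<close> gives the other. Equality is what makes pullback
  send whole cosets onto whole cosets.\<close>

lemma tot_pullback_coboundaries:
  assumes f: "f \<in> carrier Aut"
  shows "tot_pullback G K n f ` coboundaries G K act n = coboundaries G K act n"
proof -
  interpret Aut: group Aut
    by (rule group_Aut)
  interpret B: subgroup "coboundaries G K act n" "Tot G K n"
    by (rule subgroup_coboundaries)
  have sub: "tot_pullback G K n h ` coboundaries G K act n \<subseteq> coboundaries G K act n"
    if h: "h \<in> carrier Aut" for h
  proof (cases n)
    case 0
    then show ?thesis
      by (simp add: tot_pullback_def Tot_def restrict_def)
  next
    case (Suc m)
    then show ?thesis
      using h by (auto simp: tot_pullback_tot_diff tot_pullback_closed)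
  qed
  moreover have "coboundaries G K act n \<subseteq> tot_pullback G K n f ` coboundaries G K act n"
  proof
    fix b assume b: "b \<in> coboundaries G K act n"
    have "tot_pullback G K n f (tot_pullback G K n (inv\<^bsub>Aut\<^esub> f) b) = b"
      using f B.mem_carrier[OF b] by (simp flip: tot_pullback_comp add: tot_pullback_one)
    moreover have "tot_pullback G K n (inv\<^bsub>Aut\<^esub> f) b \<in> coboundaries G K act n"
      using sub[of "inv\<^bsub>Aut\<^esub> f"] f b by auto
    ultimately show "b \<in> tot_pullback G K n f ` coboundaries G K act n"
      by (metis imageI)
  qed
  ultimately show ?thesis
    using f by blast
qed

lemma cohomology_pullback_class:
  assumes f: "f \<in> carrier Aut"
  shows "cohomology_pullback G K n f (cohomology_class G K act n x)
    = cohomology_class G K act n (tot_pullback G K n f x)"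
proof -
  have "cohomology_pullback G K n f (cohomology_class G K act n x)
      = (\<lambda>b. b \<otimes>\<^bsub>Tot G K n\<^esub> tot_pullback G K n f x) ` tot_pullback G K n f ` coboundaries G K act n"
    using f
    by (auto simp: cohomology_pullback_def cohomology_class_def r_coset_def tot_pullback_mult image_iff)
  then show ?thesis
    by (auto simp: tot_pullback_coboundaries[OF f] cohomology_class_def r_coset_def)
qed

text \<open>The quotient is oriented with \<open>x\<close> inverted, as in the equation that defines
  morphisms from \<open>x\<close>.\<close>

lemma cohomology_class_eq_iff:
  assumes "x \<in> carrier (Tot G K n)" "y \<in> carrier (Tot G K n)"
  shows "cohomology_class G K act n x = cohomology_class G K act n y
    \<longleftrightarrow> y \<otimes>\<^bsub>Tot G K n\<^esub> inv\<^bsub>Tot G K n\<^esub> x \<in> coboundaries G K act n"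
proof -
  interpret T: group "Tot G K n"
    by (rule group_Tot)
  show ?thesis
    using assms subgroup_coboundaries
    by (metis T.repr_independence T.repr_independenceD T.is_group cohomology_class_def
        subgroup.rcos_module)
qed

lemma carrier_cohomology:
  "carrier (cohomology G K act n) = cohomology_class G K act n ` cocycles G K act n"
  by (auto simp: cohomology_def FactGroup_def RCOSETS_def cohomology_class_def r_coset_def)

lemma cocycles_subset: "cocycles G K act n \<subseteq> carrier (Tot G K n)"
  by (auto simp: cocycles_def kernel_def)


section \<open>Isomorphism classes of pseudomonoid structures\<close>

text \<open>In total degree 2 only the bidegrees (0,2) and (1,1) occur, and inversion permutes the
  cochains of bidegree (0,2). The pairs \<chi>, \<kappa> therefore run through all 2-cochains, and
  their differentials through all coboundaries of degree 3.\<close>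

lemma Psdmn_hom_nonempty_iff:
  "Psdmn_hom G K act x x' \<noteq> {} \<longleftrightarrow>
    (\<exists>f\<in>carrier Aut. tot_pullback G K 3 f x' \<otimes>\<^bsub>Tot G K 3\<^esub> inv\<^bsub>Tot G K 3\<^esub> x \<in> coboundaries G K act 3)"
proof -
  interpret C: group "cochains G K 0 2"
    by (rule group_cochains)
  have B: "coboundaries G K act 3 = tot_diff G K act 2 ` carrier (Tot G K 2)"
    by (simp add: eval_nat_numeral)
  let ?u = "\<lambda>\<chi> \<kappa>. \<lambda>p\<in>{..<2::nat}. if p = 0 then inv\<^bsub>cochains G K 0 2\<^esub> \<kappa> else \<chi>"
  have u: "?u \<chi> \<kappa> \<in> carrier (Tot G K 2)"
    if "\<chi> \<in> carrier (cochains G K 1 1)" "\<kappa> \<in> carrier (cochains G K 0 2)" for \<chi> \<kappa>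
    using that by (auto simp: carrier_Tot less_2_cases_iff)
  have ex: "\<exists>\<chi> \<in> carrier (cochains G K 1 1). \<exists>\<kappa> \<in> carrier (cochains G K 0 2). ?u \<chi> \<kappa> = y"
    if y: "y \<in> carrier (Tot G K 2)" for y
  proof (intro bexI)
    \<comment> \<open>The witness for \<kappa> is the inverse of \<open>y 0\<close>, since the
      packed family inverts \<kappa> once more.\<close>
    show "y 1 \<in> carrier (cochains G K 1 1)" "inv\<^bsub>cochains G K 0 2\<^esub> (y 0) \<in> carrier (cochains G K 0 2)"
      using Tot_component[OF y, of 0] Tot_component[OF y, of 1] by auto
    show "?u (y 1) (inv\<^bsub>cochains G K 0 2\<^esub> (y 0)) = y"
      using Tot_component[OF y, of 0] y
      by (auto simp: carrier_Tot PiE_iff extensional_def less_2_cases_iff)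
  qed
  have "z \<in> coboundaries G K act 3 \<longleftrightarrow> (\<exists>\<chi> \<in> carrier (cochains G K 1 1).
      \<exists>\<kappa> \<in> carrier (cochains G K 0 2). tot_diff G K act 2 (?u \<chi> \<kappa>) = z)" for z
  proof
    assume "z \<in> coboundaries G K act 3"
    then obtain y where y: "y \<in> carrier (Tot G K 2)" "tot_diff G K act 2 y = z"
      unfolding B by blast
    obtain \<chi> \<kappa> where "\<chi> \<in> carrier (cochains G K 1 1)" "\<kappa> \<in> carrier (cochains G K 0 2)" "?u \<chi> \<kappa> = y"
      using ex[OF y(1)] by blast
    with y(2) show "\<exists>\<chi> \<in> carrier (cochains G K 1 1). \<exists>\<kappa> \<in> carrier (cochains G K 0 2).
        tot_diff G K act 2 (?u \<chi> \<kappa>) = z"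
      by (intro bexI[of _ \<chi>] bexI[of _ \<kappa>]) simp_all
  next
    assume "\<exists>\<chi> \<in> carrier (cochains G K 1 1). \<exists>\<kappa> \<in> carrier (cochains G K 0 2).
        tot_diff G K act 2 (?u \<chi> \<kappa>) = z"
    then obtain \<chi> \<kappa> where c: "\<chi> \<in> carrier (cochains G K 1 1)" "\<kappa> \<in> carrier (cochains G K 0 2)"
      and d: "tot_diff G K act 2 (?u \<chi> \<kappa>) = z"
      by blast
    show "z \<in> coboundaries G K act 3"
      unfolding B d[symmetric] by (intro imageI u c)
  qed
  then show ?thesis
    by (simp add: Psdmn_hom_def) blast
qed

lemma Psdmn_iso_iff:
  assumes "x \<in> Psdmn_objects G K act" "x' \<in> Psdmn_objects G K act"
  shows "(x, x') \<in> Psdmn_iso G K act \<longleftrightarrow>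
    cohomology_class G K act 3 x \<in> orbit Aut (cohomology_pullback G K 3) (cohomology_class G K act 3 x')"
proof -
  have "x \<in> carrier (Tot G K 3)" "x' \<in> carrier (Tot G K 3)"
    using assms cocycles_subset by (auto simp: Psdmn_objects_def)
  then have "Psdmn_hom G K act x x' \<noteq> {} \<longleftrightarrow> (\<exists>f\<in>carrier Aut.
      cohomology_class G K act 3 x = cohomology_pullback G K 3 f (cohomology_class G K act 3 x'))"
    unfolding Psdmn_hom_nonempty_iff
    by (intro bex_cong refl)
      (simp add: cohomology_pullback_class cohomology_class_eq_iff tot_pullback_closed)
  with assms show ?thesis
    by (auto simp: Psdmn_iso_def orbit_def)
qed

text \<open>Pullback acts from the right, so the orbits are compared by hand: the unit gives
  reflexivity, inverses give symmetry, and products, taken in reversed order, give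
  transitivity.\<close>

lemma orbit_cohomology_class_eq_iff:
  assumes x: "x \<in> carrier (Tot G K n)" and y: "y \<in> carrier (Tot G K n)"
  defines "Orb \<equiv> \<lambda>z. orbit Aut (cohomology_pullback G K n) (cohomology_class G K act n z)"
  shows "Orb x = Orb y \<longleftrightarrow> cohomology_class G K act n x \<in> Orb y"
proof
  interpret Aut: group Aut
    by (rule group_Aut)
  note comp = tot_pullback_comp[symmetric] tot_pullback_one cohomology_pullback_class
  have mem: "cohomology_class G K act n z \<in> Orb z" if "z \<in> carrier (Tot G K n)" for z
    using that by (force simp: Orb_def orbit_def comp intro: exI[of _ "\<one>\<^bsub>Aut\<^esub>"])
  show "cohomology_class G K act n x \<in> Orb y" if "Orb x = Orb y"
    using mem[OF x] that by simp
  assume "cohomology_class G K act n x \<in> Orb y"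
  then obtain f where f: "f \<in> carrier Aut"
    and xy: "cohomology_class G K act n x = cohomology_pullback G K n f (cohomology_class G K act n y)"
    by (auto simp: Orb_def orbit_def)
  have yx: "cohomology_class G K act n y
      = cohomology_pullback G K n (inv\<^bsub>Aut\<^esub> f) (cohomology_class G K act n x)"
    using f y by (simp add: xy comp)
  have sub: "Orb u \<subseteq> Orb v" if h: "h \<in> carrier Aut"
    and "cohomology_class G K act n u = cohomology_pullback G K n h (cohomology_class G K act n v)"
    for u v h
  proof
    fix X assume "X \<in> Orb u"
    then obtain e where e: "e \<in> carrier Aut"
      and "X = cohomology_pullback G K n e (cohomology_class G K act n u)"
      by (auto simp: Orb_def orbit_def)
    \<comment> \<open>Pulling back along \<open>h\<close> and then along \<open>e\<close> is
      pullback along the composite with \<open>e\<close> applied first.\<close>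
    then have "X = cohomology_pullback G K n (h \<otimes>\<^bsub>Aut\<^esub> e) (cohomology_class G K act n v)"
      using that by (simp add: comp)
    then show "X \<in> Orb v"
      using h e by (auto simp: Orb_def orbit_def)
  qed
  show "Orb x = Orb y"
    using sub[OF f xy] sub[OF _ yx] f by auto
qed

end

text \<open>The first isomorphism theorem for sets: a map factors bijectively from the quotient by
  its kernel relation onto its image.\<close>

lemma bij_betw_quotient:
  fixes f :: "'a \<Rightarrow> 'b" and A :: "'a set"
  defines "r \<equiv> {(x, y). x \<in> A \<and> y \<in> A \<and> f x = f y}"
  shows "\<exists>\<Phi>. bij_betw \<Phi> (A // r) (f ` A) \<and> (\<forall>x\<in>A. \<Phi> (r `` {x}) = f x)"
proof -
  \<comment> \<open>Since \<open>f\<close> is constant on each class, the image of a class is a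
    singleton, and \<open>the_elem\<close> extracts its value without choosing a
    representative.\<close>
  define \<Phi> where "\<Phi> X = the_elem (f ` X)" for X
  have quot: "A // r = (\<lambda>x. r `` {x}) ` A"
    by (auto simp: quotient_def)
  have \<Phi>: "\<Phi> (r `` {x}) = f x" if "x \<in> A" for x
  proof -
    have "f ` (r `` {x}) = {f x}"
      using that by (auto simp: r_def)
    then show ?thesis
      by (simp add: \<Phi>_def)
  qed
  have "inj_on \<Phi> (A // r)"
    unfolding quot by (rule inj_onI) (auto simp: \<Phi>, auto simp: r_def)
  moreover have "\<Phi> ` (A // r) = f ` A"
    by (simp add: quot \<Phi> image_image)
  ultimately show ?thesis
    using \<Phi> by (auto simp: bij_betw_def)
qed

theorem lemma3p13:
  fixes G :: "('g, 'c) monoid_scheme" and K :: "('k, 'd) monoid_scheme"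
    and act :: "'g \<Rightarrow> 'k \<Rightarrow> 'k"
  assumes "equivariant_monoid G K act"
  shows "\<exists>\<Phi>. bij_betw \<Phi> (Psdmn_classes G K act)
             (orbits (equivariant_autos G K act) (carrier (cohomology G K act 3))
                (cohomology_pullback G K 3))
           \<and> (\<forall>x \<in> Psdmn_objects G K act.
                \<Phi> (Psdmn_iso G K act `` {x}) =
                orbit (equivariant_autos G K act) (cohomology_pullback G K 3)
                  (cohomology_class G K act 3 x))"
proof -
  interpret equivariant_monoid G K act
    by (rule assms)
  let ?A = "Psdmn_objects G K act" and ?r = "Psdmn_iso G K act"
  let ?Orb = "\<lambda>x. orbit (equivariant_autos G K act) (cohomology_pullback G K 3)
    (cohomology_class G K act 3 x)"
  \<comment> \<open>Isomorphism is thus the kernel relation of the map sending a cocycle to the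
    orbit of its class; in particular it is an equivalence relation on objects.\<close>
  have "(x, y) \<in> ?r \<longleftrightarrow> ?Orb x = ?Orb y" if "x \<in> ?A" "y \<in> ?A" for x y
    using that cocycles_subset
    by (simp add: Psdmn_iso_iff orbit_cohomology_class_eq_iff Psdmn_objects_def subset_iff)
  moreover have "?r \<subseteq> ?A \<times> ?A"
    by (auto simp: Psdmn_iso_def)
  ultimately have "?r = {(x, y). x \<in> ?A \<and> y \<in> ?A \<and> ?Orb x = ?Orb y}"
    by blast
  \<comment> \<open>Every cohomology class has a cocycle representative, so this map reaches every
    orbit.\<close>
  moreover have "orbits (equivariant_autos G K act) (carrier (cohomology G K act 3))
      (cohomology_pullback G K 3) = ?Orb ` ?A"
    by (auto simp: orbits_def carrier_cohomology Psdmn_objects_def)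
  ultimately show ?thesis
    using bij_betw_quotient[of ?A ?Orb] by (simp only: Psdmn_classes_def)
qed

end
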